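(* Let $A_1,\ldots,A_r\in\mathbb{R}_+^{n\times n}$ commute in pairs in max algebra. Then, given any $i\in\{1,\ldots,r\}$ and any eigenvalue $\alpha_i\in\Lambda(A_i)$, there exist $\alpha_j\in\Lambda(A_j)$ for all $j\neq i$ such that $V(A_1,\alpha_1)\cap\cdots\cap V(A_r,\alpha_r)$ contains a nonzero vector.
   Context: Max algebra is the semiring $(\mathbb{R}_+,\oplus,\times)$, where $\mathbb{R}_+=[0,\infty)$, $a\oplus b=\max(a,b)$ and $\times$ is ordinary multiplication. All matrix and matrix-vector operations are over this semiring: $(AB)_{ij}=\max_k a_{ik}b_{kj}$ and $(Av)_i=\max_k a_{ik}v_k$. An eigenvalue of $A\in\mathbb{R}_+^{n\times n}$ is an $\alpha\in\mathbb{R}_+$ for which there is a nonzero $v\in\mathbb{R}_+^n$ (an eigenvector) with $Av=\alpha v$. $\Lambda(A)$ denotes the set of eigenvalues of $A$, and for $\alpha\in\Lambda(A)$ the eigencone of $A$ associated with $\alpha$ is $V(A,\alpha)=\{v\in\mathbb{R}_+^n\mid Av=\alpha v\}$. *)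

theory Defs
  imports "HOL-Analysis.Analysis"
begin

(* Max algebra is carried by the nonnegative reals; elements are represented as reals, with
   nonnegativity stated through the two sets below.  The operations are meaningful as max-algebra
   operations only on these sets.  As 'n is a nonempty finite type, every Max is attained. *)

definition nonneg_vecs :: "(real ^ 'n) set" where
  "nonneg_vecs = {v. \<forall>i. 0 \<le> v $ i}"

definition nonneg_mats :: "(real ^ 'n ^ 'n) set" where
  "nonneg_mats = {A. \<forall>i j. 0 \<le> A $ i $ j}"

definition max_mult :: "real ^ 'n::finite ^ 'n \<Rightarrow> real ^ 'n ^ 'n \<Rightarrow> real ^ 'n ^ 'n" where
  "max_mult A B = (\<chi> i j. Max (range (\<lambda>k. A $ i $ k * B $ k $ j)))"

definition max_apply :: "real ^ 'n::finite ^ 'n \<Rightarrow> real ^ 'n \<Rightarrow> real ^ 'n" where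
  "max_apply A v = (\<chi> i. Max (range (\<lambda>k. A $ i $ k * v $ k)))"

definition max_eigencone :: "real ^ 'n::finite ^ 'n \<Rightarrow> real \<Rightarrow> (real ^ 'n) set" where
  "max_eigencone A \<alpha> = {v \<in> nonneg_vecs. max_apply A v = \<alpha> *\<^sub>R v}"

definition max_eigenvalues :: "real ^ 'n::finite ^ 'n \<Rightarrow> real set" where
  "max_eigenvalues A =
     {\<alpha>. 0 \<le> \<alpha> \<and> (\<exists>v \<in> nonneg_vecs. v \<noteq> 0 \<and> max_apply A v = \<alpha> *\<^sub>R v)}"

end

theory Submission
  imports Defs
begin

text \<open>
  The eigencone \<open>V(A, \<alpha>)\<close> of a matrix is a closed set of nonnegative vectors that is stable under
  nonnegative multiples and componentwise maxima, and a matrix commuting with \<open>A\<close> maps it to itself.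
  So the theorem follows by adding the matrices one at a time, once it is known that a matrix \<open>B\<close>
  which maps a nonzero closed max cone \<open>W\<close> to itself has an eigenvector in \<open>W\<close>
  (\<open>invariant_max_cone_has_eigenvector\<close>).

  That eigenvector comes from a Collatz--Wielandt minimum.  Call \<open>w \<in> W\<close> nonzero a subeigenvector
  for \<open>\<mu>\<close> if \<open>B w \<le> \<mu> w\<close>.  A vector of \<open>W\<close> with the largest possible support is one, for some
  \<open>\<mu>\<close>, and by compactness of the unit sphere there is a least \<open>\<rho>\<close> that admits one, say \<open>w\<close>.  If
  \<open>\<rho> = 0\<close> then \<open>B w = 0\<close>.  If \<open>\<rho> > 0\<close>, the vectors \<open>\<rho>\<^sup>-\<^sup>k B\<^sup>k w\<close> decrease to a limit \<open>u \<in> W\<close>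
  with \<open>B u = \<rho> u\<close>, and \<open>u\<close> is an eigenvector unless it vanishes.  But if it vanishes then
  \<open>B\<^sup>k w \<le> \<rho>\<^sup>k w / 2\<close> for some \<open>k\<close>, and the maximum of the vectors \<open>\<mu>\<^sup>-\<^sup>j B\<^sup>j w\<close> with \<open>j < k\<close>
  is a subeigenvector for \<open>\<mu> = \<rho> / 2\<^sup>1\<^sup>/\<^sup>k < \<rho>\<close>, contradicting the choice of \<open>\<rho>\<close>.
\<close>

section \<open>The action of a max-algebra matrix\<close>

lemma max_apply_le_iff: "max_apply A v $ i \<le> c \<longleftrightarrow> (\<forall>k. A $ i $ k * v $ k \<le> c)"
  by (auto simp: max_apply_def)

lemma le_max_apply: "A $ i $ k * v $ k \<le> max_apply A v $ i"
  using max_apply_le_iff[of A v i "max_apply A v $ i"] by blast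

lemma eq_if_same_upper_bounds:
  fixes x y :: real
  assumes "\<And>c. x \<le> c \<longleftrightarrow> y \<le> c"
  shows "x = y"
  using assms[of x] assms[of y] by simp

lemma nonneg_mult_Max_le_iff:
  fixes a :: real and f :: "'k::finite \<Rightarrow> real"
  assumes "0 \<le> a"
  shows "a * Max (range f) \<le> c \<longleftrightarrow> (\<forall>k. a * f k \<le> c)"
proof -
  have "mono ((*) a)"
    using assms by (simp add: mono_def mult_left_mono)
  then have "a * Max (range f) = Max ((*) a ` range f)"
    by (intro mono_Max_commute) auto
  then show ?thesis
    by auto
qed

text \<open>Both sides have the entries \<open>max\<^sub>k\<^sub>j a\<^sub>i\<^sub>k b\<^sub>k\<^sub>j v\<^sub>j\<close>; comparing upper bounds avoids the exchange of
  the two maxima.\<close>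

lemma max_apply_max_mult:
  assumes "A \<in> nonneg_mats" "v \<in> nonneg_vecs"
  shows "max_apply (max_mult A B) v = max_apply A (max_apply B v)"
proof -
  have "max_apply (max_mult A B) v $ i = max_apply A (max_apply B v) $ i" for i
  proof (rule eq_if_same_upper_bounds)
    fix c
    have v: "0 \<le> v $ j" and A: "0 \<le> A $ i $ j" for j
      using assms by (auto simp: nonneg_vecs_def nonneg_mats_def)
    have "max_apply (max_mult A B) v $ i \<le> c
        \<longleftrightarrow> (\<forall>j. v $ j * Max (range (\<lambda>k. A $ i $ k * B $ k $ j)) \<le> c)"
      by (simp add: max_apply_le_iff max_mult_def mult.commute)
    also have "\<dots> \<longleftrightarrow> (\<forall>j k. v $ j * (A $ i $ k * B $ k $ j) \<le> c)"
      by (simp only: nonneg_mult_Max_le_iff[OF v])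
    also have "\<dots> \<longleftrightarrow> (\<forall>k j. A $ i $ k * (B $ k $ j * v $ j) \<le> c)"
      by (auto simp: mult_ac)
    also have "\<dots> \<longleftrightarrow> (\<forall>k. A $ i $ k * Max (range (\<lambda>j. B $ k $ j * v $ j)) \<le> c)"
      by (simp only: nonneg_mult_Max_le_iff[OF A])
    also have "\<dots> \<longleftrightarrow> max_apply A (max_apply B v) $ i \<le> c"
      unfolding max_apply_le_iff by (simp add: max_apply_def)
    finally show "max_apply (max_mult A B) v $ i \<le> c \<longleftrightarrow> max_apply A (max_apply B v) $ i \<le> c" .
  qed
  then show ?thesis
    by (simp add: vec_eq_iff)
qed

lemma max_apply_mono:
  assumes "A \<in> nonneg_mats" "v \<le> w"
  shows "max_apply A v \<le> max_apply A w"
proof -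
  have "A $ i $ k * v $ k \<le> max_apply A w $ i" for i k
  proof -
    have "A $ i $ k * v $ k \<le> A $ i $ k * w $ k"
      using assms by (auto simp: nonneg_mats_def less_eq_vec_def intro: mult_left_mono)
    also have "\<dots> \<le> max_apply A w $ i"
      by (rule le_max_apply)
    finally show ?thesis .
  qed
  then show ?thesis
    by (simp add: less_eq_vec_def max_apply_le_iff)
qed

lemma max_apply_sup:
  assumes "A \<in> nonneg_mats"
  shows "max_apply A (sup v w) = sup (max_apply A v) (max_apply A w)"
proof (rule order.antisym)
  have "A $ i $ k * max (v $ k) (w $ k) \<le> max (max_apply A v $ i) (max_apply A w $ i)" for i k
    using le_max_apply[of A i k v] le_max_apply[of A i k w] by (auto simp: max_def)
  then show "max_apply A (sup v w) \<le> sup (max_apply A v) (max_apply A w)"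
    by (simp add: less_eq_vec_def max_apply_le_iff sup_vec_def sup_max)
qed (use assms in \<open>auto intro: max_apply_mono\<close>)

lemma max_apply_scaleR:
  assumes "0 \<le> c"
  shows "max_apply A (c *\<^sub>R v) = c *\<^sub>R max_apply A v"
proof -
  have "max_apply A (c *\<^sub>R v) $ i = (c *\<^sub>R max_apply A v) $ i" for i
  proof (rule eq_if_same_upper_bounds)
    fix d
    show "max_apply A (c *\<^sub>R v) $ i \<le> d \<longleftrightarrow> (c *\<^sub>R max_apply A v) $ i \<le> d"
      using nonneg_mult_Max_le_iff[OF assms, of "\<lambda>k. A $ i $ k * v $ k" d]
      by (simp add: max_apply_le_iff) (simp add: max_apply_def mult_ac)
  qed
  then show ?thesis
    by (simp add: vec_eq_iff)
qed

lemma max_apply_nonneg: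
  assumes "A \<in> nonneg_mats" "v \<in> nonneg_vecs"
  shows "max_apply A v \<in> nonneg_vecs"
proof -
  have "0 \<le> max_apply A v $ i" for i
  proof -
    have "0 \<le> A $ i $ i * v $ i"
      using assms by (simp add: nonneg_mats_def nonneg_vecs_def)
    also have "\<dots> \<le> max_apply A v $ i"
      by (rule le_max_apply)
    finally show ?thesis .
  qed
  then show ?thesis
    by (simp add: nonneg_vecs_def)
qed

lemma continuous_on_Max_image:
  fixes f :: "'k \<Rightarrow> 'a::topological_space \<Rightarrow> real"
  assumes "finite K" "K \<noteq> {}" "\<And>k. k \<in> K \<Longrightarrow> continuous_on S (f k)"
  shows "continuous_on S (\<lambda>x. Max ((\<lambda>k. f k x) ` K))"
  using assms by (induction K rule: finite_ne_induct) (auto intro!: continuous_intros)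

lemma continuous_on_max_apply: "continuous_on S (max_apply A)"
  unfolding max_apply_def
  by (intro continuous_intros continuous_on_Max_image) auto

section \<open>Max cones\<close>

definition closed_max_cone :: "(real ^ 'n::finite) set \<Rightarrow> bool" where
  "closed_max_cone W \<longleftrightarrow> closed W \<and> W \<subseteq> nonneg_vecs
     \<and> (\<forall>v \<in> W. \<forall>w \<in> W. sup v w \<in> W) \<and> (\<forall>v \<in> W. \<forall>c \<ge> 0. c *\<^sub>R v \<in> W)"

lemma closed_max_cone_eigencone:
  fixes A :: "real ^ 'n::finite ^ 'n"
  assumes "A \<in> nonneg_mats" "0 \<le> \<alpha>"
  shows "closed_max_cone (max_eigencone A \<alpha>)"
proof -
  have "max_eigencone A \<alpha> = (\<Inter>i. {v. 0 \<le> v $ i}) \<inter> {v. max_apply A v = \<alpha> *\<^sub>R v}"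
    by (auto simp: max_eigencone_def nonneg_vecs_def)
  moreover have "closed {v. max_apply A v = \<alpha> *\<^sub>R v}"
    by (intro closed_Collect_eq continuous_intros continuous_on_max_apply)
  moreover have "closed {v :: real ^ 'n. 0 \<le> v $ i}" for i
    by (intro closed_Collect_le continuous_intros)
  ultimately have "closed (max_eigencone A \<alpha>)"
    by (simp add: closed_INT closed_Int)
  moreover have "sup v w \<in> max_eigencone A \<alpha>"
    if "v \<in> max_eigencone A \<alpha>" "w \<in> max_eigencone A \<alpha>" for v w
  proof -
    have "sup (\<alpha> *\<^sub>R v) (\<alpha> *\<^sub>R w) = \<alpha> *\<^sub>R sup v w"
      using assms(2) by (simp add: vec_eq_iff sup_vec_def sup_max max_mult_distrib_left)
    moreover have "sup v w \<in> nonneg_vecs"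
      using that by (auto simp: max_eigencone_def nonneg_vecs_def sup_vec_def sup_max le_max_iff_disj)
    ultimately show ?thesis
      using that by (simp add: max_eigencone_def max_apply_sup[OF assms(1)])
  qed
  moreover have "c *\<^sub>R v \<in> max_eigencone A \<alpha>" if "v \<in> max_eigencone A \<alpha>" "0 \<le> c" for v c
    using that by (auto simp: max_eigencone_def max_apply_scaleR nonneg_vecs_def)
  ultimately show ?thesis
    by (auto simp: closed_max_cone_def max_eigencone_def)
qed

lemma closed_max_cone_INT:
  assumes "J \<noteq> {}" "\<And>j. j \<in> J \<Longrightarrow> closed_max_cone (W j)"
  shows "closed_max_cone (\<Inter>j\<in>J. W j)"
proof -
  obtain j where "j \<in> J"
    using assms(1) by blast
  moreover from this have "W j \<subseteq> nonneg_vecs"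
    using assms(2) by (simp add: closed_max_cone_def)
  ultimately have "(\<Inter>j\<in>J. W j) \<subseteq> nonneg_vecs"
    by blast
  then show ?thesis
    using assms(2) by (simp add: closed_max_cone_def closed_INT)
qed

lemma max_eigencone_invariant:
  assumes "A \<in> nonneg_mats" "B \<in> nonneg_mats" "max_mult A B = max_mult B A" "0 \<le> \<alpha>"
    and "v \<in> max_eigencone A \<alpha>"
  shows "max_apply B v \<in> max_eigencone A \<alpha>"
proof -
  have v: "v \<in> nonneg_vecs" "max_apply A v = \<alpha> *\<^sub>R v"
    using assms(5) by (auto simp: max_eigencone_def)
  have "max_apply A (max_apply B v) = max_apply B (max_apply A v)"
    using assms v by (metis max_apply_max_mult)
  then show ?thesis
    using v assms by (simp add: max_eigencone_def max_apply_nonneg max_apply_scaleR)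
qed

lemma nonneg_eigenvalue:
  assumes "A \<in> nonneg_mats" "v \<in> nonneg_vecs" "v \<noteq> 0" "max_apply A v = \<alpha> *\<^sub>R v"
  shows "0 \<le> \<alpha>"
proof -
  obtain i where "v $ i \<noteq> 0"
    using assms(3) by (auto simp: vec_eq_iff)
  with assms(2) have "0 < v $ i"
    by (simp add: nonneg_vecs_def less_le)
  moreover have "0 \<le> \<alpha> * v $ i"
    using max_apply_nonneg[OF assms(1,2)] assms(4) by (simp add: nonneg_vecs_def)
  ultimately show ?thesis
    by (simp add: zero_le_mult_iff)
qed

section \<open>Subeigenvectors in an invariant max cone\<close>

text \<open>The sum of the ratios \<open>w\<^sub>i / v\<^sub>i\<close> bounds each of them; an index with \<open>v\<^sub>i = 0\<close> contributes \<open>0\<close>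
  because division by zero yields zero.\<close>

lemma le_scaleR_if_support_subset:
  fixes v w :: "real ^ 'n::finite"
  assumes "v \<in> nonneg_vecs" "w \<in> nonneg_vecs" "{i. w $ i \<noteq> 0} \<subseteq> {i. v $ i \<noteq> 0}"
  shows "\<exists>\<mu>\<ge>0. w \<le> \<mu> *\<^sub>R v"
proof -
  define \<mu> where "\<mu> = (\<Sum>i\<in>UNIV. w $ i / v $ i)"
  have nonneg: "0 \<le> w $ i / v $ i" for i
    using assms by (simp add: nonneg_vecs_def)
  have "w $ i \<le> \<mu> * v $ i" for i
  proof (cases "v $ i = 0")
    case True
    then have "w $ i = 0"
      using assms(3) by blast
    with True show ?thesis
      by simp
  next
    case False
    then have "0 < v $ i"
      using assms(1) by (simp add: nonneg_vecs_def less_le)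
    moreover have "w $ i / v $ i \<le> \<mu>"
      unfolding \<mu>_def using nonneg by (intro member_le_sum) auto
    ultimately show ?thesis
      by (simp add: pos_divide_le_eq)
  qed
  moreover have "0 \<le> \<mu>"
    unfolding \<mu>_def using nonneg by (rule sum_nonneg)
  ultimately show ?thesis
    by (auto simp: less_eq_vec_def)
qed

text \<open>For \<open>w \<in> W\<close> of largest support, \<open>B w\<close> cannot have a nonzero entry where \<open>w\<close> has none, for
  otherwise \<open>sup w (B w)\<close> would be a vector of \<open>W\<close> with a larger support.\<close>

lemma exists_subeigenvector:
  fixes B :: "real ^ 'n::finite ^ 'n"
  assumes W: "closed_max_cone W" and inv: "\<And>v. v \<in> W \<Longrightarrow> max_apply B v \<in> W"
    and v: "v \<in> W" "v \<noteq> 0"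
  shows "\<exists>w\<in>W. \<exists>\<mu>\<ge>0. w \<noteq> 0 \<and> max_apply B w \<le> \<mu> *\<^sub>R w"
proof -
  let ?supp = "\<lambda>w :: real ^ 'n. {i. w $ i \<noteq> 0}"
  define P where "P = (\<lambda>w. w \<in> W \<and> w \<noteq> 0)"
  have bdd: "\<forall>w. P w \<longrightarrow> card (?supp w) < Suc (CARD('n))"
    by (auto simp: less_Suc_eq_le intro: card_mono)
  obtain w where "P w" and max: "\<And>w'. P w' \<Longrightarrow> card (?supp w') \<le> card (?supp w)"
    using ex_has_greatest_nat[OF _ bdd, of v] v unfolding P_def by blast
  then have w: "w \<in> W" "w \<noteq> 0"
    by (auto simp: P_def)
  have Wnonneg: "W \<subseteq> nonneg_vecs" and Wsup: "sup w (max_apply B w) \<in> W"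
    using W w inv unfolding closed_max_cone_def by auto
  have nonneg: "0 \<le> w $ i" "0 \<le> max_apply B w $ i" for i
    using w inv Wnonneg by (auto simp: nonneg_vecs_def)
  have supp: "?supp (sup w (max_apply B w)) = ?supp w \<union> ?supp (max_apply B w)"
    using nonneg by (auto simp: sup_vec_def sup_max max_def) (metis order.antisym)+
  then have "sup w (max_apply B w) \<noteq> 0"
    using w(2) by (auto simp: vec_eq_iff)
  with Wsup have "card (?supp w \<union> ?supp (max_apply B w)) \<le> card (?supp w)"
    using max[of "sup w (max_apply B w)"] supp by (simp add: P_def)
  then have "?supp (max_apply B w) \<subseteq> ?supp w"
    by (metis Un_upper1 Un_upper2 card_seteq finite)
  then have "\<exists>\<mu>\<ge>0. max_apply B w \<le> \<mu> *\<^sub>R w"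
    using w inv Wnonneg by (intro le_scaleR_if_support_subset) auto
  with w show ?thesis
    by blast
qed

text \<open>The least value with a subeigenvector is attained because \<open>B w \<le> \<mu> w\<close> is a closed condition
  on the pair \<open>(\<mu>, w)\<close> and subeigenvectors can be taken on the unit sphere, which is compact.\<close>

lemma exists_least_subeigenvalue:
  fixes B :: "real ^ 'n::finite ^ 'n"
  assumes W: "closed_max_cone W" and inv: "\<And>v. v \<in> W \<Longrightarrow> max_apply B v \<in> W"
    and v: "v \<in> W" "v \<noteq> 0"
  obtains w \<rho> where "w \<in> W" "w \<noteq> 0" "0 \<le> \<rho>" "max_apply B w \<le> \<rho> *\<^sub>R w"
    and "\<And>w' \<mu>. w' \<in> W \<Longrightarrow> w' \<noteq> 0 \<Longrightarrow> 0 \<le> \<mu> \<Longrightarrow> max_apply B w' \<le> \<mu> *\<^sub>R w' \<Longrightarrow> \<rho> \<le> \<mu>"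
proof -
  obtain w0 M where w0: "w0 \<in> W" "w0 \<noteq> 0" "0 \<le> M" "max_apply B w0 \<le> M *\<^sub>R w0"
    using exists_subeigenvector[OF W inv v] by blast
  define K where
    "K = ({0..M} \<times> (sphere 0 1 \<inter> W)) \<inter> {(\<mu>, w). max_apply B w \<le> \<mu> *\<^sub>R w}"
  have normalize: "(\<mu>, (1 / norm w) *\<^sub>R w) \<in> K"
    if "w \<in> W" "w \<noteq> 0" "0 \<le> \<mu>" "\<mu> \<le> M" "max_apply B w \<le> \<mu> *\<^sub>R w" for \<mu> w
  proof -
    have "(1 / norm w) *\<^sub>R max_apply B w \<le> (1 / norm w) *\<^sub>R (\<mu> *\<^sub>R w)"
      using that by (intro scaleR_left_mono) auto
    then show ?thesis
      using that W by (auto simp: K_def closed_max_cone_def max_apply_scaleR mult.commute)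
  qed
  have "{(\<mu>, w). max_apply B w \<le> \<mu> *\<^sub>R w}
      = (\<Inter>i. {p :: real \<times> (real ^ 'n). max_apply B (snd p) $ i \<le> (fst p *\<^sub>R snd p) $ i})"
    by (auto simp: less_eq_vec_def)
  moreover have
    "closed {p :: real \<times> (real ^ 'n). max_apply B (snd p) $ i \<le> (fst p *\<^sub>R snd p) $ i}" for i
    by (intro closed_Collect_le continuous_intros
          continuous_on_compose2[OF continuous_on_max_apply]) auto
  ultimately have "closed {(\<mu>, w). max_apply B w \<le> \<mu> *\<^sub>R w}"
    by auto
  then have "compact K"
    using W unfolding K_def closed_max_cone_def
    by (intro compact_Int_closed compact_Times) auto
  moreover have "K \<noteq> {}"
    using normalize[OF w0(1-3) order.refl w0(4)] by auto
  ultimately obtain p where p: "p \<in> K" "\<And>q. q \<in> K \<Longrightarrow> fst p \<le> fst q"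
    using continuous_attains_inf[of K fst] continuous_on_fst[OF continuous_on_id] by blast
  obtain \<rho> w where [simp]: "p = (\<rho>, w)"
    by fastforce
  show ?thesis
  proof
    show "w \<in> W" "w \<noteq> 0" "0 \<le> \<rho>" "max_apply B w \<le> \<rho> *\<^sub>R w"
      using p(1) by (auto simp: K_def)
    fix w' \<mu>
    assume *: "w' \<in> W" "w' \<noteq> 0" "0 \<le> \<mu>" "max_apply B w' \<le> \<mu> *\<^sub>R w'"
    show "\<rho> \<le> \<mu>"
    proof (cases "\<mu> \<le> M")
      case True
      then show ?thesis
        using p(2)[OF normalize] * by fastforce
    next
      case False
      then show ?thesis
        using p(1) by (auto simp: K_def)
    qed
  qed
qed

text \<open>If \<open>y 0, y 1, \<dots>\<close> is a rescaled orbit of \<open>B\<close> that returns below its start, then \<open>B\<close> maps the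
  maximum of \<open>y 0, \<dots>, y m\<close> to \<open>\<mu>\<close> times the maximum of \<open>y 1, \<dots>, y (m + 1)\<close>, and the additional
  term \<open>y (m + 1)\<close> is absorbed by \<open>y 0\<close>.\<close>

lemma subeigenvector_from_returning_orbit:
  assumes W: "closed_max_cone W" and B: "B \<in> nonneg_mats" and \<mu>: "0 \<le> \<mu>"
    and y: "\<And>j. y j \<in> W" "\<And>j. max_apply B (y j) = \<mu> *\<^sub>R y (Suc j)"
    and return: "y (Suc m) \<le> y 0"
  shows "\<exists>w\<in>W. y 0 \<le> w \<and> max_apply B w \<le> \<mu> *\<^sub>R w"
proof -
  have "\<exists>s\<in>W. y 0 \<le> s \<and> max_apply B s \<le> \<mu> *\<^sub>R sup s (y (Suc m))" for m
  proof (induction m)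
    case 0
    show ?case
      using y \<mu> by (intro bexI[of _ "y 0"]) (auto intro: scaleR_left_mono)
  next
    case (Suc m)
    then obtain s where s: "s \<in> W" "y 0 \<le> s" "max_apply B s \<le> \<mu> *\<^sub>R sup s (y (Suc m))"
      by blast
    let ?s = "sup s (y (Suc m))"
    have "\<mu> *\<^sub>R ?s \<le> \<mu> *\<^sub>R sup ?s (y (Suc (Suc m)))"
      and "\<mu> *\<^sub>R y (Suc (Suc m)) \<le> \<mu> *\<^sub>R sup ?s (y (Suc (Suc m)))"
      using \<mu> by (auto intro: scaleR_left_mono)
    then have "max_apply B ?s \<le> \<mu> *\<^sub>R sup ?s (y (Suc (Suc m)))"
      using s(3) y(2)[of "Suc m"] by (auto simp: max_apply_sup[OF B])
    moreover have "?s \<in> W"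
      using W s(1) y(1) unfolding closed_max_cone_def by blast
    moreover have "y 0 \<le> ?s"
      using s(2) by (simp add: le_supI1)
    ultimately show ?case
      by blast
  qed
  then obtain s where "s \<in> W" "y 0 \<le> s" "max_apply B s \<le> \<mu> *\<^sub>R sup s (y (Suc m))"
    by blast
  moreover from this return have "sup s (y (Suc m)) = s"
    by (simp add: sup_absorb1 order.trans)
  ultimately show ?thesis
    by auto
qed

section \<open>Eigenvectors in an invariant max cone\<close>

lemma decreasing_nonneg_vecs_tendsto:
  fixes x :: "nat \<Rightarrow> real ^ 'n::finite"
  assumes "\<And>k. x (Suc k) \<le> x k" "\<And>k. x k \<in> nonneg_vecs"
  obtains u where "x \<longlonglongrightarrow> u"
proof -
  have "\<exists>L. (\<lambda>k. x k $ i) \<longlonglongrightarrow> L" for i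
  proof -
    have "decseq (\<lambda>k. x k $ i)"
      using assms(1) by (auto simp: less_eq_vec_def intro: decseq_SucI)
    moreover have "\<forall>k. 0 \<le> x k $ i"
      using assms(2) by (auto simp: nonneg_vecs_def)
    ultimately show ?thesis
      using decseq_convergent by blast
  qed
  then obtain L where "\<And>i. (\<lambda>k. x k $ i) \<longlonglongrightarrow> L i"
    by metis
  then have "x \<longlonglongrightarrow> (\<chi> i. L i)"
    by (intro vec_tendstoI) simp
  then show ?thesis
    by (rule that)
qed

lemma eventually_le_half_if_tendsto_0:
  fixes x :: "nat \<Rightarrow> real ^ 'n::finite"
  assumes "x \<longlonglongrightarrow> 0" "w \<in> nonneg_vecs" "\<And>k. x k \<le> w"
  shows "eventually (\<lambda>k. x k \<le> (1/2) *\<^sub>R w) sequentially"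
proof -
  have "eventually (\<lambda>k. x k $ i \<le> w $ i / 2) sequentially" for i
  proof (cases "w $ i = 0")
    case True
    then show ?thesis
      using assms(3) by (auto simp: less_eq_vec_def intro!: always_eventually) metis
  next
    case False
    then have "0 < w $ i / 2"
      using assms(2) by (simp add: nonneg_vecs_def less_le)
    moreover have "(\<lambda>k. x k $ i) \<longlonglongrightarrow> 0"
      using tendsto_vec_nth[OF assms(1), of i] by simp
    ultimately have "eventually (\<lambda>k. x k $ i < w $ i / 2) sequentially"
      by (rule order_tendstoD(2)[rotated])
    then show ?thesis
      by (rule eventually_mono) simp
  qed
  then show ?thesis
    by (simp add: less_eq_vec_def eventually_all_finite)
qed

theorem invariant_max_cone_has_eigenvector:
  fixes B :: "real ^ 'n::finite ^ 'n"
  assumes W: "closed_max_cone W" and B: "B \<in> nonneg_mats"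
    and inv: "\<And>v. v \<in> W \<Longrightarrow> max_apply B v \<in> W"
    and v: "v \<in> W" "v \<noteq> 0"
  shows "\<exists>u\<in>W. \<exists>\<rho>\<ge>0. u \<noteq> 0 \<and> max_apply B u = \<rho> *\<^sub>R u"
proof -
  obtain w \<rho> where w: "w \<in> W" "w \<noteq> 0" and \<rho>: "0 \<le> \<rho>" "max_apply B w \<le> \<rho> *\<^sub>R w"
    and least: "\<And>w' \<mu>. w' \<in> W \<Longrightarrow> w' \<noteq> 0 \<Longrightarrow> 0 \<le> \<mu> \<Longrightarrow> max_apply B w' \<le> \<mu> *\<^sub>R w' \<Longrightarrow> \<rho> \<le> \<mu>"
    using exists_least_subeigenvalue[OF W inv v] by metis
  have Wnonneg: "W \<subseteq> nonneg_vecs" and "closed W"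
    and Wscale: "\<And>c v. 0 \<le> c \<Longrightarrow> v \<in> W \<Longrightarrow> c *\<^sub>R v \<in> W"
    using W unfolding closed_max_cone_def by auto
  show ?thesis
  proof (cases "\<rho> = 0")
    case True
    have "max_apply B w \<in> nonneg_vecs"
      using w inv Wnonneg by blast
    then have "max_apply B w = \<rho> *\<^sub>R w"
      using \<rho>(2) True by (auto simp: vec_eq_iff less_eq_vec_def nonneg_vecs_def intro: order.antisym)
    then show ?thesis
      using w \<rho> by blast
  next
    case False
    with \<rho> have "0 < \<rho>"
      by simp
    define x where "x = rec_nat w (\<lambda>_ v. (1 / \<rho>) *\<^sub>R max_apply B v)"
    have x0: "x 0 = w" and xSuc: "\<And>k. x (Suc k) = (1 / \<rho>) *\<^sub>R max_apply B (x k)"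
      by (simp_all add: x_def)
    then have Bx: "max_apply B (x k) = \<rho> *\<^sub>R x (Suc k)" for k
      using \<open>0 < \<rho>\<close> by simp
    have xW: "x k \<in> W" for k
      using \<open>0 < \<rho>\<close> by (induction k) (auto simp: x0 xSuc w intro: Wscale inv)
    have dec: "x (Suc k) \<le> x k" for k
    proof (induction k)
      case 0
      have "(1 / \<rho>) *\<^sub>R max_apply B w \<le> (1 / \<rho>) *\<^sub>R (\<rho> *\<^sub>R w)"
        using \<rho> by (intro scaleR_left_mono) auto
      then show ?case
        using \<open>0 < \<rho>\<close> by (simp add: x0 xSuc)
    next
      case (Suc k)
      then show ?case
        using \<open>0 < \<rho>\<close> max_apply_mono[OF B] xSuc by (metis scaleR_left_mono zero_le_divide_1_iff less_imp_le)
    qed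
    obtain u where u: "x \<longlonglongrightarrow> u"
      using decreasing_nonneg_vecs_tendsto[of x] dec xW Wnonneg by blast
    have "u \<in> W"
      using closed_sequentially[OF \<open>closed W\<close> _ u] xW by blast
    moreover have "max_apply B u = \<rho> *\<^sub>R u"
    proof (rule LIMSEQ_unique)
      show "(\<lambda>k. max_apply B (x k)) \<longlonglongrightarrow> max_apply B u"
        by (rule continuous_on_tendsto_compose[OF continuous_on_max_apply[of UNIV] u]) auto
      show "(\<lambda>k. max_apply B (x k)) \<longlonglongrightarrow> \<rho> *\<^sub>R u"
        unfolding Bx by (intro tendsto_scaleR tendsto_const LIMSEQ_Suc u)
    qed
    moreover have "u \<noteq> 0"
    proof
      assume "u = 0"
      have "x k \<le> w" for k
        using decseq_SucI[of x] dec x0 by (metis decseqD le0)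
      then have "eventually (\<lambda>k. x k \<le> (1/2) *\<^sub>R w) sequentially"
        using eventually_le_half_if_tendsto_0 u \<open>u = 0\<close> w Wnonneg by blast
      \<comment> \<open>An index of the form \<open>Suc N\<close> makes the root below well defined.\<close>
      then obtain N where "\<And>k. N \<le> k \<Longrightarrow> x k \<le> (1/2) *\<^sub>R w"
        unfolding eventually_sequentially by blast
      then have m: "x (Suc N) \<le> (1/2) *\<^sub>R w"
        by simp
      \<comment> \<open>Spreading the factor \<open>1/2\<close> over \<open>Suc N\<close> steps: rescaling the orbit with \<open>\<rho> * q\<close> instead
        of \<open>\<rho>\<close> still brings it below its start after these steps.\<close>
      define q :: real where "q = root (Suc N) (1/2)"
      have q: "0 < q" "q < 1" "q ^ Suc N = 1/2"
        by (auto simp: q_def real_root_pow_pos2 simp del: power_Suc)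
      define y where "y j = (1 / q ^ j) *\<^sub>R x j" for j
      have "(1 / q ^ Suc N) *\<^sub>R x (Suc N) \<le> (1 / q ^ Suc N) *\<^sub>R ((1/2) *\<^sub>R w)"
        using m q by (intro scaleR_left_mono) auto
      then have "y (Suc N) \<le> y 0"
        unfolding y_def q(3) by (simp add: x0)
      moreover have "y j \<in> W" for j
        using q xW by (auto simp: y_def intro: Wscale)
      moreover have "max_apply B (y j) = (\<rho> * q) *\<^sub>R y (Suc j)" for j
        using q Bx by (simp add: y_def max_apply_scaleR)
      moreover have "0 \<le> \<rho> * q"
        using \<rho> q by simp
      ultimately obtain w' where w': "w' \<in> W" "w \<le> w'" "max_apply B w' \<le> (\<rho> * q) *\<^sub>R w'"
        using subeigenvector_from_returning_orbit[OF W B, of "\<rho> * q" y N]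
        by (auto simp: y_def x0)
      have "w' \<noteq> 0"
      proof
        assume "w' = 0"
        moreover have "w \<in> nonneg_vecs"
          using w(1) Wnonneg by blast
        ultimately have "w = 0"
          using w'(2) by (auto simp: vec_eq_iff less_eq_vec_def nonneg_vecs_def intro: order.antisym)
        with w show False
          by simp
      qed
      then have "\<rho> \<le> \<rho> * q"
        using least w' \<open>0 \<le> \<rho> * q\<close> by blast
      then show False
        using \<open>0 < \<rho>\<close> q by simp
    qed
    ultimately show ?thesis
      using \<rho> by blast
  qed
qed

section \<open>Common eigenvectors of commuting matrices\<close>

theorem theorem3p5:
  fixes A :: "nat \<Rightarrow> real ^ 'n::finite ^ 'n" and r i :: nat and \<alpha>\<^sub>i :: real
  assumes "\<And>j. j \<in> {1..r} \<Longrightarrow> A j \<in> nonneg_mats"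
    and "\<And>j k. j \<in> {1..r} \<Longrightarrow> k \<in> {1..r} \<Longrightarrow> max_mult (A j) (A k) = max_mult (A k) (A j)"
    and "i \<in> {1..r}"
    and "\<alpha>\<^sub>i \<in> max_eigenvalues (A i)"
  shows "\<exists>\<alpha> :: nat \<Rightarrow> real. \<alpha> i = \<alpha>\<^sub>i
           \<and> (\<forall>j \<in> {1..r} - {i}. \<alpha> j \<in> max_eigenvalues (A j))
           \<and> (\<exists>v \<in> (\<Inter>j \<in> {1..r}. max_eigencone (A j) (\<alpha> j)). v \<noteq> 0)"
proof -
  \<comment> \<open>The index \<open>i\<close> comes first, so that its eigenvalue can be prescribed; the eigenvalue of each
    further matrix is whatever its invariant cone provides.\<close>
  have "\<exists>\<alpha>. \<alpha> i = \<alpha>\<^sub>i \<and> (\<exists>v \<in> (\<Inter>j \<in> insert i J. max_eigencone (A j) (\<alpha> j)). v \<noteq> 0)"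
    if "finite J" "J \<subseteq> {1..r} - {i}" for J
    using that
  proof (induction J)
    case empty
    show ?case
      using assms(4) by (intro exI[of _ "\<lambda>_. \<alpha>\<^sub>i"]) (auto simp: max_eigenvalues_def max_eigencone_def)
  next
    case (insert k J)
    then obtain \<alpha> v where "\<alpha> i = \<alpha>\<^sub>i" and v: "v \<noteq> 0"
      and vcone: "\<And>j. j \<in> insert i J \<Longrightarrow> v \<in> max_eigencone (A j) (\<alpha> j)"
      by auto
    have k: "k \<in> {1..r}" "k \<noteq> i" "k \<notin> J" and J: "insert i J \<subseteq> {1..r}"
      using insert assms(3) by auto
    have nonneg: "0 \<le> \<alpha> j" if "j \<in> insert i J" for j
      using nonneg_eigenvalue[of "A j" v "\<alpha> j"] vcone[OF that] v assms(1) J that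
      by (auto simp: max_eigencone_def)
    let ?W = "\<Inter>j \<in> insert i J. max_eigencone (A j) (\<alpha> j)"
    have "closed_max_cone ?W"
      using nonneg J assms(1) by (intro closed_max_cone_INT closed_max_cone_eigencone) auto
    moreover have "max_apply (A k) x \<in> ?W" if "x \<in> ?W" for x
    proof
      fix j assume j: "j \<in> insert i J"
      then have "j \<in> {1..r}"
        using J by blast
      then show "max_apply (A k) x \<in> max_eigencone (A j) (\<alpha> j)"
        using k j that nonneg by (intro max_eigencone_invariant assms(1,2)) auto
    qed
    moreover have "v \<in> ?W"
      using vcone by blast
    ultimately obtain u \<rho> where u: "u \<in> ?W" "u \<noteq> 0" "max_apply (A k) u = \<rho> *\<^sub>R u"
      using invariant_max_cone_has_eigenvector[of ?W "A k" v] assms(1) k(1) v by blast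
    then have "u \<in> max_eigencone (A k) \<rho>"
      by (auto simp: max_eigencone_def)
    with u k have "u \<in> (\<Inter>j \<in> insert i (insert k J). max_eigencone (A j) ((\<alpha>(k := \<rho>)) j))"
      by auto
    then show ?case
      using u(2) \<open>\<alpha> i = \<alpha>\<^sub>i\<close> k(2) by (intro exI[of _ "\<alpha>(k := \<rho>)"]) auto
  qed
  from this[of "{1..r} - {i}"] obtain \<alpha> v where \<alpha>: "\<alpha> i = \<alpha>\<^sub>i" and v: "v \<noteq> 0"
    and vcone: "v \<in> (\<Inter>j \<in> {1..r}. max_eigencone (A j) (\<alpha> j))"
    using assms(3) by (auto simp: insert_absorb)
  have "\<alpha> j \<in> max_eigenvalues (A j)" if "j \<in> {1..r}" for j
  proof -
    have "v \<in> nonneg_vecs" "max_apply (A j) v = \<alpha> j *\<^sub>R v"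
      using vcone that by (auto simp: max_eigencone_def)
    with v show ?thesis
      using nonneg_eigenvalue[OF assms(1)[OF that]] by (auto simp: max_eigenvalues_def)
  qed
  with \<alpha> v vcone show ?thesis
    by blast
qed

end
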